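(* Let $m\geq 1$ and let $t_1,t_2,\ldots,t_m$ be positive integers. The number of $(t_1,t_2,\ldots,t_m)$-core partitions is finite if and only if $\gcd(t_1,t_2,\ldots,t_m)=1$.
   Context: A partition is a finite non-increasing sequence of positive integers $\lambda=(\lambda_1,\ldots,\lambda_r)$; the empty partition ($r=0$) is allowed. Its Young diagram is the left-justified array of boxes with $\lambda_i$ boxes in the $i$-th row. The hook length of a box is the number of boxes that are directly to its right in the same row, or directly below it in the same column, or the box itself. For a positive integer $t$, $\lambda$ is a $t$-core partition if none of its hook lengths is a multiple of $t$ (so the empty partition is a $t$-core for every $t$). $\lambda$ is a $(t_1,\ldots,t_m)$-core partition if it is simultaneously a $t_i$-core partition for every $1\leq i\leq m$. Partitions of all sizes are counted together. *)

theory Defs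
  imports Main
begin

definition is_partition :: "nat list \<Rightarrow> bool" where
  "is_partition la \<longleftrightarrow> sorted_wrt (\<ge>) la \<and> (\<forall>x\<in>set la. 0 < x)"

text \<open>Boxes are pairs (row, column), both counted from 0; rows run downwards and columns to the right.\<close>

definition young_diagram :: "nat list \<Rightarrow> (nat \<times> nat) set" where
  "young_diagram la = {(i, j). i < length la \<and> j < la ! i}"

definition hook :: "nat list \<Rightarrow> nat \<times> nat \<Rightarrow> (nat \<times> nat) set" where
  "hook la b = {(i, j) \<in> young_diagram la.
     (i = fst b \<and> snd b < j) \<or> (j = snd b \<and> fst b < i) \<or> (i, j) = b}"

definition hook_length :: "nat list \<Rightarrow> nat \<times> nat \<Rightarrow> nat" where
  "hook_length la b = card (hook la b)"

definition is_core :: "nat \<Rightarrow> nat list \<Rightarrow> bool" where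
  "is_core t la \<longleftrightarrow> is_partition la \<and> (\<forall>b\<in>young_diagram la. \<not> t dvd hook_length la b)"

definition simultaneous_cores :: "nat \<Rightarrow> (nat \<Rightarrow> nat) \<Rightarrow> nat list set" where
  "simultaneous_cores m t = {la. is_partition la \<and> (\<forall>i\<in>{1..m}. is_core (t i) la)}"

end

theory Submission
  imports Defs
begin

text \<open>
  The first-column hook lengths $b_i = \lambda_i + r - 1 - i$ of a partition with rows $0, \ldots, r - 1$ determine
  all hook lengths: those in row $i$ are the differences $b_i - y$ with $y < b_i$ not itself a
  first-column hook length. So the set $B$ of first-column hook lengths of a $t$-core is closed
  under subtracting $t$, hence under subtracting any element of the semigroup generated by the
  $t_i$. If the gcd is 1, this semigroup contains all $n \ge N$; as $0 \notin B$, the largest element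
  $\lambda_0 + r - 1$ of $B$ is below $N$, which leaves finitely many partitions. If the gcd is
  $d > 1$, then for every $k$ the partition with first-column hook lengths
  $1, d + 1, \ldots, (k - 1) d + 1$ is a $d$-core, hence a $t_i$-core for every $i$.
\<close>

section \<open>Hook lengths read off the first column\<close>

text \<open>Here \<open>c\<close> is the length of column \<open>j\<close>. The box together with
  its arm fills \<open>la ! i - j\<close> cells, the leg \<open>c - Suc i\<close>.\<close>

lemma hook_length_eq:
  assumes "i < length la" "j < la ! i" "c \<le> length la"
    and c: "\<And>k. k < length la \<Longrightarrow> j < la ! k \<longleftrightarrow> k < c"
  shows "hook_length la (i, j) = la ! i + c - (i + j + 1)"
proof -
  have "i < c"
    using assms by blast
  have "hook la (i, j) = {i} \<times> {j..<la ! i} \<union> {i<..<c} \<times> {j}"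
    using assms unfolding hook_def young_diagram_def by auto
  moreover have "card ({i} \<times> {j..<la ! i} \<union> {i<..<c} \<times> {j}) = (la ! i - j) + (c - Suc i)"
    by (subst card_Un_disjoint) auto
  ultimately show ?thesis
    using \<open>i < c\<close> \<open>j < la ! i\<close> unfolding hook_length_def by simp
qed

definition first_column_hook :: "nat list \<Rightarrow> nat \<Rightarrow> nat" where
  "first_column_hook la i = la ! i + length la - Suc i"

lemma is_partition_nth_mono:
  assumes "is_partition la" "i \<le> k" "k < length la"
  shows "la ! k \<le> la ! i"
  using assms unfolding is_partition_def sorted_wrt_iff_nth_less
  by (cases "i = k") auto

lemma first_column_hook_pos:
  assumes "is_partition la" "i < length la"
  shows "0 < first_column_hook la i"
proof -
  have "0 < la ! i"
    using assms unfolding is_partition_def by auto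
  then show ?thesis
    using assms(2) unfolding first_column_hook_def by simp
qed

lemma first_column_hook_strict_antimono:
  assumes "is_partition la" "i < k" "k < length la"
  shows "first_column_hook la k < first_column_hook la i"
  using is_partition_nth_mono[of la i k] assms unfolding first_column_hook_def by simp

text \<open>The rows whose first-column hook exceeds \<open>y\<close> are the first \<open>c\<close>
  rows. Some column has length exactly \<open>c\<close>, and its hook in row \<open>i\<close> has
  the required length.\<close>

lemma hook_length_of_gap:
  assumes la: "is_partition la" and i: "i < length la"
    and y: "y < first_column_hook la i" "y \<notin> first_column_hook la ` {..<length la}"
  shows "\<exists>j < la ! i. hook_length la (i, j) = first_column_hook la i - y"
proof -
  \<comment> \<open>The guard \<open>k < length la\<close> makes \<open>P (length la)\<close> true,
    so the least element exists even if every first-column hook exceeds \<open>y\<close>.\<close>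
  define P where "P k \<longleftrightarrow> k < length la \<longrightarrow> first_column_hook la k < y" for k
  define c where "c = (LEAST k. P k)"
  have "P (length la)"
    by (simp add: P_def)
  then have "P c" and c: "c \<le> length la"
    unfolding c_def by (auto intro: LeastI Least_le)
  have below: "y < first_column_hook la k" if "k < c" for k
  proof -
    have "\<not> P k" and "k < length la"
      using not_less_Least that c unfolding c_def by auto
    then show ?thesis
      using y(2) unfolding P_def by (metis imageI lessThan_iff linorder_neqE_nat)
  qed
  have above: "first_column_hook la k < y" if "c \<le> k" "k < length la" for k
    using \<open>P c\<close> that first_column_hook_strict_antimono[OF la, of c k]
    unfolding P_def by (cases "k = c") auto
  \<comment> \<open>Obtained by solving
    \<open>la ! i + c - (i + j + 1) = first_column_hook la i - y\<close> for \<open>j\<close>;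
    \<open>yc\<close> ensures that the subtraction is not truncated.\<close>
  define j where "j = y + c - length la"
  have yc: "length la \<le> y + c"
    using above[of c] c unfolding first_column_hook_def by (cases "c = length la") auto
  have "j < la ! k \<longleftrightarrow> k < c" if k: "k < length la" for k
  proof
    assume "k < c"
    then have "la ! (c - 1) \<le> la ! k"
      using is_partition_nth_mono[OF la, of k "c - 1"] c by simp
    moreover have "y < first_column_hook la (c - 1)"
      using below \<open>k < c\<close> by simp
    ultimately show "j < la ! k"
      using c \<open>k < c\<close> yc unfolding j_def first_column_hook_def by simp
  next
    assume "j < la ! k"
    show "k < c"
    proof (rule ccontr)
      assume "\<not> k < c"
      then have "c < length la" "la ! k \<le> la ! c"
        using k is_partition_nth_mono[OF la, of c k] by auto
      moreover have "first_column_hook la c < y"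
        using above \<open>c < length la\<close> by simp
      ultimately show False
        using \<open>j < la ! k\<close> yc unfolding j_def first_column_hook_def by simp
    qed
  qed
  moreover have "i < c"
    using y(1) above[of i] i by force
  ultimately have "j < la ! i" "hook_length la (i, j) = la ! i + c - (i + j + 1)"
    using i c hook_length_eq[of i la j c] by auto
  moreover have "la ! i + c - (i + j + 1) = first_column_hook la i - y"
    using yc i unfolding j_def first_column_hook_def by simp
  ultimately show ?thesis
    by auto
qed

text \<open>If \<open>x - t\<close> were a gap, the row of \<open>x\<close> would contain a hook of
  length exactly \<open>t\<close>.\<close>

lemma is_core_first_column_hooks_diff:
  assumes core: "is_core t la" and t: "0 < t" "t \<le> x"
    and x: "x \<in> first_column_hook la ` {..<length la}"
  shows "x - t \<in> first_column_hook la ` {..<length la}"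
proof (rule ccontr)
  assume gap: "x - t \<notin> first_column_hook la ` {..<length la}"
  obtain i where i: "i < length la" "x = first_column_hook la i"
    using x by auto
  then obtain j where "j < la ! i" "hook_length la (i, j) = t"
    using hook_length_of_gap[of la i "x - t"] gap core t unfolding is_core_def by auto
  then show False
    using core i(1) unfolding is_core_def young_diagram_def by fastforce
qed

section \<open>Large elements of numerical semigroups\<close>

text \<open>Induction on \<open>T\<close>: from a large \<open>n\<close>, subtract a bounded
  multiple of the new generator \<open>a\<close> to reach a multiple of \<open>Gcd T\<close>, which
  the induction hypothesis covers. For empty \<open>T\<close> the gcd is 0, leaving only
  \<open>n = 0\<close>.\<close>

lemma eventually_mem_semigroup:
  fixes S :: "nat set"
  assumes S: "0 \<in> S" "\<And>x y. x \<in> S \<Longrightarrow> y \<in> S \<Longrightarrow> x + y \<in> S"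
    and "finite T" "T \<subseteq> S"
  shows "\<exists>N. \<forall>n\<ge>N. Gcd T dvd n \<longrightarrow> n \<in> S"
  using \<open>finite T\<close> \<open>T \<subseteq> S\<close>
proof (induction T)
  case empty
  then show ?case
    using S(1) by auto
next
  case (insert a T)
  then have mult: "a * k \<in> S" for k
    using S by (induction k) auto
  from insert obtain N where N: "n \<in> S" if "N \<le> n" "Gcd T dvd n" for n
    by auto
  define g where "g = Gcd T"
  \<comment> \<open>At most \<open>a * g\<close> is subtracted below, so the remainder is still at
    least \<open>N\<close>.\<close>
  have "n \<in> S" if n: "N + a * g \<le> n" "gcd a g dvd n" for n
  proof (cases "a = 0 \<or> g = 0")
    case True
    then show ?thesis
      using N mult n unfolding g_def[symmetric] by (auto elim!: dvdE)
  next
    case False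
    obtain k where k: "n = gcd a g * k"
      using n(2) by blast
    obtain x y where xy: "a * x = g * y + gcd a g"
      using bezout_nat[of a g] False by auto
    \<comment> \<open>By Bezout, \<open>a * (x * k)\<close> is congruent to \<open>n\<close> modulo
      \<open>g\<close>; reducing the factor modulo \<open>g\<close> keeps this and bounds
      it.\<close>
    define u where "u = (x * k) mod g"
    have "u < g"
      using False by (simp add: u_def)
    then have "a * u \<le> a * g"
      by simp
    have "a * (x * k) = g * (y * k) + n"
      using xy k by (metis distrib_right mult.assoc)
    then have "(a * u) mod g = n mod g"
      unfolding u_def by (metis mod_mult_right_eq mod_mult_self4)
    then have "g dvd n - a * u"
      using n(1) \<open>a * u \<le> a * g\<close> by (metis mod_eq_dvd_iff_nat le_trans le_add2)
    moreover have "N \<le> n - a * u"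
      using n(1) \<open>a * u \<le> a * g\<close> by linarith
    ultimately have "n - a * u \<in> S"
      using N unfolding g_def by blast
    then have "a * u + (n - a * u) \<in> S"
      using S(2) mult by blast
    then show ?thesis
      using n(1) \<open>a * u \<le> a * g\<close> by simp
  qed
  then show ?case
    by (auto simp: g_def)
qed

section \<open>Finiteness when the gcd is 1\<close>

text \<open>The corner hook bounds both the largest part and the number of parts.\<close>

lemma finite_partitions_bounded_hook:
  "finite {la. is_partition la \<and> (la \<noteq> [] \<longrightarrow> first_column_hook la 0 < N)}"
proof (rule finite_subset)
  show "finite {la :: nat list. set la \<subseteq> {..N} \<and> length la \<le> N}"
    by (rule finite_lists_length_le) simp
  show "{la. is_partition la \<and> (la \<noteq> [] \<longrightarrow> first_column_hook la 0 < N)}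
    \<subseteq> {la. set la \<subseteq> {..N} \<and> length la \<le> N}"
  proof clarify
    fix la
    assume la: "is_partition la" and hook: "la \<noteq> [] \<longrightarrow> first_column_hook la 0 < N"
    show "set la \<subseteq> {..N} \<and> length la \<le> N"
    proof (cases "la = []")
      case False
      then have len: "0 < length la" and "0 < la ! 0"
        using la unfolding is_partition_def by auto
      then have "la ! 0 \<le> N" "length la \<le> N"
        using hook unfolding first_column_hook_def by auto
      moreover have "x \<le> la ! 0" if "x \<in> set la" for x
        using that is_partition_nth_mono[OF la, of 0] by (auto simp: in_set_conv_nth)
      ultimately show ?thesis
        by force
    qed simp
  qed
qed

lemma finite_simultaneous_cores:
  assumes pos: "\<And>i. i \<in> {1..m} \<Longrightarrow> t i > 0" and gcd: "(GCD i\<in>{1..m}. t i) = 1"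
  shows "finite (simultaneous_cores m t)"
proof -
  define B where "B la = first_column_hook la ` {..<length la}" for la
  \<comment> \<open>Quantifying over all cores at once yields a single bound \<open>N\<close> valid
    for every core.\<close>
  define S where "S = {s. \<forall>la\<in>simultaneous_cores m t. \<forall>x\<in>B la. s \<le> x \<longrightarrow> x - s \<in> B la}"
  have "x + y \<in> S" if "x \<in> S" "y \<in> S" for x y
    using that unfolding S_def by (auto simp flip: diff_diff_left)
  moreover have "t ` {1..m} \<subseteq> S"
    using pos is_core_first_column_hooks_diff unfolding S_def B_def simultaneous_cores_def by auto
  ultimately obtain N where N: "n \<in> S" if "N \<le> n" for n
    using eventually_mem_semigroup[of S "t ` {1..m}"] gcd unfolding S_def by auto
  have "first_column_hook la 0 < N" if la: "la \<in> simultaneous_cores m t" and "la \<noteq> []" for la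
  proof (rule ccontr)
    assume "\<not> first_column_hook la 0 < N"
    then have "first_column_hook la 0 \<in> S"
      using N by simp
    moreover have "first_column_hook la 0 \<in> B la"
      using \<open>la \<noteq> []\<close> unfolding B_def by auto
    \<comment> \<open>The corner hook is subtracted from itself.\<close>
    ultimately have "0 \<in> B la"
      using la unfolding S_def by fastforce
    then show False
      using la first_column_hook_pos[of la] unfolding B_def simultaneous_cores_def by force
  qed
  then show ?thesis
    by (intro finite_subset[OF _ finite_partitions_bounded_hook[of N]])
      (auto simp: simultaneous_cores_def)
qed

section \<open>Infinitely many cores when the gcd exceeds 1\<close>

text \<open>With d = \<open>Suc e\<close>, the first-column hooks are 1, d + 1, ..., (k - 1) d + 1,
  read from the bottom row up. For \<open>e = 1\<close> this is the usual staircase.\<close>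

definition wide_staircase :: "nat \<Rightarrow> nat \<Rightarrow> nat list" where
  "wide_staircase e k = map (\<lambda>i. 1 + (k - 1 - i) * e) [0..<k]"

lemma length_wide_staircase [simp]: "length (wide_staircase e k) = k"
  by (simp add: wide_staircase_def)

lemma nth_wide_staircase: "i < k \<Longrightarrow> wide_staircase e k ! i = 1 + (k - 1 - i) * e"
  by (simp add: wide_staircase_def)

lemma is_partition_wide_staircase: "is_partition (wide_staircase e k)"
  unfolding is_partition_def sorted_wrt_iff_nth_less
  by (auto simp: nth_wide_staircase) (auto simp: wide_staircase_def)

text \<open>With d = \<open>Suc e\<close>, a hook in column \<open>j\<close> is congruent to 1 - (j
  + q) modulo d, where q is j / e rounded up. For j = 0 this is 1; otherwise j + q - 1 lies strictly
  between (q - 1) d and q d.\<close>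

lemma is_core_wide_staircase:
  assumes "0 < e"
  shows "is_core (Suc e) (wide_staircase e k)"
  unfolding is_core_def
proof (intro conjI ballI is_partition_wide_staircase)
  fix b
  assume "b \<in> young_diagram (wide_staircase e k)"
  then obtain i j where b: "b = (i, j)" and i: "i < k" and j: "j < wide_staircase e k ! i"
    unfolding young_diagram_def by auto
  define q where "q = (j + e - 1) div e"
  \<comment> \<open>Column j ends in the row with q rows below it.\<close>
  have q: "j < 1 + l * e \<longleftrightarrow> q \<le> l" for l
  proof -
    have "q \<le> l \<longleftrightarrow> (j + e - 1) div e < Suc l"
      by (auto simp: q_def)
    also have "\<dots> \<longleftrightarrow> j + e - 1 < Suc l * e"
      using assms by (rule div_less_iff_less_mult)
    also have "\<dots> \<longleftrightarrow> j < 1 + l * e"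
      using assms by auto
    finally show ?thesis
      by simp
  qed
  have qi: "q \<le> k - 1 - i"
    using q j i by (simp add: nth_wide_staircase)
  have "hook_length (wide_staircase e k) (i, j)
      = wide_staircase e k ! i + (k - q) - (i + j + 1)"
  proof (rule hook_length_eq)
    fix l
    assume "l < length (wide_staircase e k)"
    then have l: "l < k"
      by simp
    show "j < wide_staircase e k ! l \<longleftrightarrow> l < k - q"
      unfolding nth_wide_staircase[OF l] q using l by linarith
  qed (use i j in simp_all)
  moreover define l where "l = k - 1 - i"
  moreover have "j \<le> l * e"
    using q[of l] qi unfolding l_def by simp
  \<comment> \<open>The right-hand side is the first-column hook of row \<open>i\<close>; the
    additive form avoids truncated subtraction.\<close>
  ultimately have hook: "hook_length (wide_staircase e k) (i, j) + (j + q) = 1 + l * Suc e"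
    using i qi nth_wide_staircase[OF i, of e, folded l_def] unfolding mult_Suc_right by linarith
  show "\<not> Suc e dvd hook_length (wide_staircase e k) b"
  proof
    assume "Suc e dvd hook_length (wide_staircase e k) b"
    then obtain h where "hook_length (wide_staircase e k) (i, j) = Suc e * h"
      using b by auto
    then have eq: "Suc e * h + (j + q) = 1 + l * Suc e"
      using hook by simp
    show False
    proof (cases q)
      case 0
      then have "Suc e * h = 1 + l * Suc e"
        using q[of 0] eq by simp
      then have "Suc e dvd 1 + l * Suc e"
        by (metis dvd_triv_left)
      then have "Suc e dvd 1"
        by (simp only: dvd_add_left_iff[OF dvd_triv_right])
      then show False
        using assms by simp
    next
      case (Suc p)
      \<comment> \<open>Column \<open>j\<close> misses the row with \<open>p\<close> rows below it
        and meets the next one up. Hence \<open>j + q - 1\<close>, a multiple of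
        \<open>Suc e\<close> by \<open>eq\<close>, falls between consecutive multiples.\<close>
      have "1 + p * e \<le> j" "j \<le> q * e"
        using q[of p] q[of q] Suc by auto
      then have "p * Suc e < l * Suc e - Suc e * h" "l * Suc e - Suc e * h < Suc p * Suc e"
        using eq Suc assms by auto
      then have "p * Suc e < (l - h) * Suc e" "(l - h) * Suc e < Suc p * Suc e"
        unfolding diff_mult_distrib mult.commute[of "Suc e" h] by blast+
      then show False
        by (simp only: mult_less_cancel2) auto
    qed
  qed
qed

text \<open>A hook length divisible by \<open>t i\<close> would be divisible by
  \<open>Suc e\<close>, so every wide staircase qualifies; their lengths tell them apart.\<close>

lemma infinite_simultaneous_cores:
  assumes e: "0 < e" and dvd: "\<And>i. i \<in> {1..m} \<Longrightarrow> Suc e dvd t i"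
  shows "infinite (simultaneous_cores m t)"
proof
  assume "finite (simultaneous_cores m t)"
  moreover have "range (wide_staircase e) \<subseteq> simultaneous_cores m t"
    using is_core_wide_staircase[OF e] dvd
    unfolding simultaneous_cores_def is_core_def by (blast intro: dvd_trans)
  moreover have "inj (wide_staircase e)"
    by (metis injI length_wide_staircase)
  ultimately show False
    using finite_imageD finite_subset infinite_UNIV_nat by blast
qed

theorem theorem1p1:
  fixes m :: nat and t :: "nat \<Rightarrow> nat"
  assumes "m \<ge> 1"
    and "\<And>i. i \<in> {1..m} \<Longrightarrow> t i > 0"
  shows "finite (simultaneous_cores m t) \<longleftrightarrow> (GCD i\<in>{1..m}. t i) = 1"
proof
  assume fin: "finite (simultaneous_cores m t)"
  define d where "d = (GCD i\<in>{1..m}. t i)"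
  have dvd: "d dvd t i" if "i \<in> {1..m}" for i
    using that unfolding d_def by (intro Gcd_dvd) auto
  \<comment> \<open>As \<open>m \<ge> 1\<close>, \<open>d\<close> divides the positive number
    \<open>t 1\<close>.\<close>
  have "0 < d"
    using dvd[of 1] assms by (intro Nat.gr0I) force
  have "d = 1"
  proof (rule ccontr)
    assume "d \<noteq> 1"
    then have "0 < d - 1" "d = Suc (d - 1)"
      using \<open>0 < d\<close> by auto
    then show False
      using infinite_simultaneous_cores[of "d - 1" m t] dvd fin by auto
  qed
  then show "(GCD i\<in>{1..m}. t i) = 1"
    unfolding d_def .
next
  assume "(GCD i\<in>{1..m}. t i) = 1"
  then show "finite (simultaneous_cores m t)"
    using finite_simultaneous_cores assms(2) by blast
qed

end
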